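(* Let $H\in\mathbb{C}^{n\times n}$ be a positive semidefinite matrix. If $C\in\mathbb{C}^{n\times n}$ is nonsingular and $C^*HC$ is uniform, then $\operatorname{rank}H\le 1$. Furthermore, $H$ is $\mathcal U$-apportionable if and only if $\operatorname{rank}H\le 1$.
   Context: A complex square matrix $B=[b_{kj}]$ is uniform if there is a real number $c\ge 0$ with $|b_{kj}|=c$ for all $k,j$. A matrix $A\in\mathbb{C}^{n\times n}$ is $\mathcal U$-apportionable if there is an $n\times n$ unitary matrix $U$ such that $UAU^*$ is uniform. Positive semidefinite means Hermitian with all eigenvalues nonnegative. *)

theory Defs
  imports
    "Jordan_Normal_Form.Schur_Decomposition"
    "Jordan_Normal_Form.DL_Rank"
begin

definition uniform_mat :: "complex mat \<Rightarrow> bool" where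
  "uniform_mat B \<longleftrightarrow> square_mat B \<and>
     (\<exists>c::real. c \<ge> 0 \<and> (\<forall>k < dim_row B. \<forall>j < dim_col B. cmod (B $$ (k, j)) = c))"

definition hermitian_mat :: "complex mat \<Rightarrow> bool" where
  "hermitian_mat A \<longleftrightarrow> square_mat A \<and> mat_adjoint A = A"

definition unitary_mat :: "complex mat \<Rightarrow> bool" where
  "unitary_mat U \<longleftrightarrow> square_mat U \<and> mat_adjoint U * U = 1\<^sub>m (dim_row U)"

(* eigenvalues have type complex, so "nonnegative" includes being real *)
definition psd_mat :: "complex mat \<Rightarrow> bool" where
  "psd_mat A \<longleftrightarrow> hermitian_mat A \<and>
     (\<forall>k. eigenvalue A k \<longrightarrow> k \<in> \<real> \<and> Re k \<ge> 0)"

definition U_apportionable :: "complex mat \<Rightarrow> bool" where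
  "U_apportionable A \<longleftrightarrow> square_mat A \<and>
     (\<exists>U \<in> carrier_mat (dim_row A) (dim_row A).
        unitary_mat U \<and> uniform_mat (U * A * mat_adjoint U))"

end

theory Submission
  imports Defs "Jordan_Normal_Form.Spectral_Radius"
begin

text \<open>
  A positive semidefinite \<open>H\<close> is a Gram matrix \<open>W\<^sup>* W\<close>: a Householder reflection turns an
  eigenvector into a multiple of the first basis vector and splits off its eigenvalue.
  If \<open>C\<^sup>* H C = (W C)\<^sup>* (W C)\<close> is uniform, then all columns of \<open>W C\<close> have the same length and
  any two of them attain equality in the Cauchy--Schwarz inequality, so they are parallel and
  \<open>rank H \<le> 1\<close>. Conversely, a Hermitian matrix of rank at most 1 has the form \<open>t v v\<^sup>*\<close>, and a
  reflection taking \<open>v\<close> to a multiple of the all-ones vector makes it uniform.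
\<close>

section \<open>Adjoints and products, entry by entry\<close>

lemma mat_adjoint_carrier [simp]:
  "A \<in> carrier_mat m n \<Longrightarrow> mat_adjoint A \<in> carrier_mat n m"
  unfolding mat_adjoint_def by auto

lemma dim_mat_adjoint [simp]:
  "dim_row (mat_adjoint A) = dim_col A" "dim_col (mat_adjoint A) = dim_row A"
  unfolding mat_adjoint_def by auto

lemma mat_adjoint_index [simp]:
  fixes A :: "complex mat"
  assumes "i < dim_col A" "j < dim_row A"
  shows "mat_adjoint A $$ (i, j) = cnj (A $$ (j, i))"
  using assms unfolding mat_adjoint_def by (simp add: mat_of_rows_def)

lemma mat_adjoint_adjoint [simp]: "mat_adjoint (mat_adjoint A) = (A :: complex mat)"
  by (rule eq_matI) auto

lemma mult_mat_index:
  assumes "A \<in> carrier_mat m k" "B \<in> carrier_mat k n" "i < m" "j < n"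
  shows "(A * B) $$ (i, j) = (\<Sum>l<k. A $$ (i, l) * B $$ (l, j))"
  using assms by (auto simp: scalar_prod_def atLeast0LessThan intro!: sum.cong)

lemma mult_mat_vec_index:
  assumes "A \<in> carrier_mat m k" "v \<in> carrier_vec k" "i < m"
  shows "(A *\<^sub>v v) $ i = (\<Sum>l<k. A $$ (i, l) * v $ l)"
  using assms by (auto simp: scalar_prod_def atLeast0LessThan intro!: sum.cong)

lemma mat_adjoint_mult:
  fixes A B :: "complex mat"
  assumes A: "A \<in> carrier_mat m k" and B: "B \<in> carrier_mat k n"
  shows "mat_adjoint (A * B) = mat_adjoint B * mat_adjoint A"
proof (rule eq_matI)
  fix i j
  assume "i < dim_row (mat_adjoint B * mat_adjoint A)"
    and "j < dim_col (mat_adjoint B * mat_adjoint A)"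
  then have ij: "i < n" "j < m" using A B by auto
  have "mat_adjoint (A * B) $$ (i, j) = cnj (\<Sum>l<k. A $$ (j, l) * B $$ (l, i))"
    using ij A B by (subst mult_mat_index[OF A B, symmetric]) auto
  also have "\<dots> = (\<Sum>l<k. mat_adjoint B $$ (i, l) * mat_adjoint A $$ (l, j))"
    using ij A B by (auto simp: mult.commute intro!: sum.cong)
  also have "\<dots> = (mat_adjoint B * mat_adjoint A) $$ (i, j)"
    by (subst mult_mat_index[of _ n k _ m]) (use ij A B in auto)
  finally show "mat_adjoint (A * B) $$ (i, j) = (mat_adjoint B * mat_adjoint A) $$ (i, j)" .
qed (use A B in auto)

lemma hermitian_mat_index:
  assumes "hermitian_mat A" "A \<in> carrier_mat n n" "i < n" "j < n"
  shows "A $$ (i, j) = cnj (A $$ (j, i))"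
  using assms mat_adjoint_index[of i A j] unfolding hermitian_mat_def by simp

section \<open>Householder reflections\<close>

text \<open>Householder's reflection along \<open>v - w\<close>. If \<open>v = w\<close> the coefficient is
  \<open>2 / 0 = 0\<close> and the reflection degenerates to the identity, as it should.\<close>

lemma reflection_exists:
  fixes v w :: "nat \<Rightarrow> complex"
  assumes norm: "(\<Sum>k<n. v k * cnj (v k)) = (\<Sum>k<n. w k * cnj (w k))"
    and real: "(\<Sum>k<n. v k * cnj (w k)) \<in> \<real>"
  obtains Q where "Q \<in> carrier_mat n n" "hermitian_mat Q" "Q * Q = 1\<^sub>m n"
    "Q *\<^sub>v vec n v = vec n w"
proof
  define z where "z k = v k - w k" for k
  define S where "S = (\<Sum>k<n. z k * cnj (z k))"
  define c where "c = 2 / S"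
  define Q where "Q = mat n n (\<lambda>(i, j). (if i = j then 1 else 0) - c * (z i * cnj (z j)))"
  have Q_index: "Q $$ (i, j) = (if i = j then 1 else 0) - c * (z i * cnj (z j))"
    if "i < n" "j < n" for i j
    using that by (simp add: Q_def)
  have S_real: "S = of_real (\<Sum>k<n. (cmod (z k))\<^sup>2)"
    unfolding S_def of_real_sum complex_norm_square ..
  \<comment> \<open>This identity makes the quadratic terms of \<open>Q * Q\<close> cancel. It
    covers \<open>S = 0\<close> as well, because then \<open>c = 0\<close>.\<close>
  have cS: "c * c * S = 2 * c"
    by (simp add: c_def)
  have c_real: "cnj c = c"
    by (simp add: c_def S_real)
  show carrier: "Q \<in> carrier_mat n n" by (simp add: Q_def)
  show "hermitian_mat Q"
    unfolding hermitian_mat_def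
  proof
    show "mat_adjoint Q = Q"
    proof (rule eq_matI)
      fix i j assume "i < dim_row Q" "j < dim_col Q"
      then have "i < n" "j < n" using carrier by auto
      then show "mat_adjoint Q $$ (i, j) = Q $$ (i, j)"
        using carrier by (auto simp: Q_index c_real mult.commute)
    qed (use carrier in auto)
  qed (use carrier in auto)
  show "Q * Q = 1\<^sub>m n"
  proof (rule eq_matI)
    fix i j assume "i < dim_row (1\<^sub>m n)" "j < dim_col (1\<^sub>m n)"
    then have ij: "i < n" "j < n" by auto
    have "(Q * Q) $$ (i, j) = (\<Sum>k<n. Q $$ (i, k) * Q $$ (k, j))"
      by (rule mult_mat_index[OF carrier carrier ij])
    also have "\<dots> = (\<Sum>k<n. (if i = k then Q $$ (k, j) else 0)
        - c * (z i * ((if k = j then cnj (z k) else 0)))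
        + c * c * (z i * cnj (z j)) * (z k * cnj (z k)))"
      using ij by (intro sum.cong refl) (auto simp: Q_index algebra_simps)
    also have "\<dots> = Q $$ (i, j) - c * (z i * cnj (z j)) + c * c * S * (z i * cnj (z j))"
      using ij by (simp add: sum.distrib sum_subtractf sum_distrib_left[symmetric] S_def)
    also have "\<dots> = 1\<^sub>m n $$ (i, j)"
      using ij by (simp add: cS Q_index)
    finally show "(Q * Q) $$ (i, j) = 1\<^sub>m n $$ (i, j)" .
  qed (use carrier in auto)
  \<comment> \<open>A real inner product is symmetric. Together with the equal norms this gives that
    the squared length \<open>S\<close> of \<open>v - w\<close> is twice the inner product of
    \<open>v\<close> with \<open>v - w\<close>.\<close>
  have "cnj (\<Sum>k<n. v k * cnj (w k)) = (\<Sum>k<n. v k * cnj (w k))"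
    using real by (simp add: Reals_cnj_iff)
  then have vw: "(\<Sum>k<n. w k * cnj (v k)) = (\<Sum>k<n. v k * cnj (w k))"
    by (simp add: mult.commute)
  have "S = 2 * (\<Sum>k<n. v k * cnj (z k))"
    using norm vw
    by (simp add: S_def z_def algebra_simps sum.distrib sum_subtractf)
  then have vz: "(\<Sum>k<n. v k * cnj (z k)) = S / 2" by simp
  show "Q *\<^sub>v vec n v = vec n w"
  proof (rule eq_vecI)
    fix i assume "i < dim_vec (vec n w)"
    then have i: "i < n" by simp
    have "(Q *\<^sub>v vec n v) $ i = (\<Sum>k<n. Q $$ (i, k) * v k)"
      using mult_mat_vec_index[OF carrier _ i, of "vec n v"] by simp
    also have "\<dots> = (\<Sum>k<n. (if i = k then v k else 0) - c * z i * (v k * cnj (z k)))"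
      using i by (intro sum.cong refl) (auto simp: Q_index algebra_simps)
    also have "\<dots> = v i - c * z i * (S / 2)"
      using i by (simp add: sum_subtractf sum_distrib_left[symmetric] vz)
    also have "\<dots> = w i"
    \<comment> \<open>If \<open>S = 0\<close>, then \<open>z\<close> vanishes and \<open>v\<close>
      and \<open>w\<close> agree. Otherwise \<open>c * S / 2 = 1\<close>, and exactly
      \<open>z i\<close> is subtracted from \<open>v i\<close>.\<close>
    proof (cases "S = 0")
      case True
      then have "(\<Sum>k<n. (cmod (z k))\<^sup>2) = 0" using S_real by (simp only: of_real_eq_0_iff)
      then have "\<forall>k\<in>{..<n}. (cmod (z k))\<^sup>2 = 0"
        by (subst (asm) sum_nonneg_eq_0_iff) auto
      then have "v i = w i" using i by (auto simp: z_def)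
      then show ?thesis using True by simp
    qed (simp add: c_def z_def field_simps)
    finally show "(Q *\<^sub>v vec n v) $ i = vec n w $ i" using i by simp
  qed (use carrier in auto)
qed

text \<open>Since the multiple of \<open>w\<close> may be chosen freely, its modulus can be used to
  match the length of \<open>v\<close> and its phase to make the inner product with \<open>v\<close>
  real. These are the two conditions for a Householder reflection.\<close>

lemma reflection_to_line:
  fixes v w :: "complex vec"
  assumes v: "v \<in> carrier_vec n" and w: "w \<in> carrier_vec n" "w \<noteq> 0\<^sub>v n"
  obtains Q a where "Q \<in> carrier_mat n n" "hermitian_mat Q" "Q * Q = 1\<^sub>m n"
    "Q *\<^sub>v v = a \<cdot>\<^sub>v w"
proof -
  define p where "p = (\<Sum>k<n. v $ k * cnj (w $ k))"
  \<comment> \<open>\<open>u\<close> is the phase of \<open>p\<close>, so that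
    \<open>p * cnj u\<close> is the real number \<open>cmod p\<close>. For \<open>p = 0\<close> any
    unit number would do, whereas \<open>sgn 0 = 0\<close> would spoil the length of
    \<open>a * w\<close>.\<close>
  define u where "u = (if p = 0 then 1 else sgn p)"
  define Nv Nw where "Nv = (\<Sum>k<n. (cmod (v $ k))\<^sup>2)" and "Nw = (\<Sum>k<n. (cmod (w $ k))\<^sup>2)"
  define a where "a = of_real (sqrt (Nv / Nw)) * u"
  have "cmod u = 1" by (simp add: u_def norm_sgn)
  then have uu: "u * cnj u = 1" by (simp add: complex_norm_square[symmetric] del: of_real_power)
  have "sgn p * of_real (cmod p) = p" by (cases "p = 0") (simp_all add: sgn_div_norm scaleR_conv_of_real)
  then have pu: "p * cnj u = of_real (cmod p)" if "p \<noteq> 0"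
    using uu that by (metis mult.assoc mult.commute mult.left_neutral u_def)
  have Nv: "Nv \<ge> 0" unfolding Nv_def by (simp add: sum_nonneg)
  have Nw: "Nw > 0"
  proof -
    obtain k where "k < n" "w $ k \<noteq> 0"
      using w by (metis carrier_vecD eq_vecI index_zero_vec)
    then show ?thesis unfolding Nw_def by (intro sum_pos2[of _ k]) auto
  qed
  have "a * cnj a = of_real (sqrt (Nv / Nw) * sqrt (Nv / Nw)) * (u * cnj u)"
    unfolding a_def by (simp only: complex_cnj_mult complex_cnj_complex_of_real of_real_mult mult_ac)
  then have aa: "a * cnj a = of_real (Nv / Nw)"
    using Nv Nw by (simp add: uu)
  have "(\<Sum>k<n. (a * w $ k) * cnj (a * w $ k)) = (a * cnj a) * of_real Nw"
    unfolding Nw_def of_real_sum sum_distrib_left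
    by (intro sum.cong refl) (simp add: complex_norm_square algebra_simps del: of_real_power)
  also have "\<dots> = of_real Nv" using Nw unfolding aa by simp
  also have "\<dots> = (\<Sum>k<n. v $ k * cnj (v $ k))"
    unfolding Nv_def of_real_sum complex_norm_square ..
  finally have norm: "(\<Sum>k<n. v $ k * cnj (v $ k)) = (\<Sum>k<n. (a * w $ k) * cnj (a * w $ k))"
    by simp
  have "(\<Sum>k<n. v $ k * cnj (a * w $ k)) = cnj a * p"
    by (simp add: p_def sum_distrib_left algebra_simps)
  also have "\<dots> = of_real (sqrt (Nv / Nw)) * (p * cnj u)"
    by (simp add: a_def)
  also have "\<dots> \<in> \<real>" using pu by (cases "p = 0") auto
  finally have real: "(\<Sum>k<n. v $ k * cnj (a * w $ k)) \<in> \<real>" .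
  obtain Q where Q: "Q \<in> carrier_mat n n" "hermitian_mat Q" "Q * Q = 1\<^sub>m n"
    "Q *\<^sub>v vec n (($) v) = vec n (\<lambda>k. a * w $ k)"
    using reflection_exists[OF norm real] by metis
  moreover have "vec n (($) v) = v" "vec n (\<lambda>k. a * w $ k) = a \<cdot>\<^sub>v w"
    using v w by auto
  ultimately show thesis using that by metis
qed

section \<open>Gram factorization of positive semidefinite matrices\<close>

lemma mult_mat_regroup:
  fixes A B C D :: "'a :: semiring_1 mat"
  assumes "A \<in> carrier_mat n n" "B \<in> carrier_mat n n" "C \<in> carrier_mat n n" "D \<in> carrier_mat n n"
  shows "(A * B) * (C * D) = A * (B * C) * D"
  using assms by (simp add: assoc_mult_mat[of _ n n _ n _ n])

lemma involution_similar:
  fixes A Q :: "complex mat"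
  assumes A: "A \<in> carrier_mat n n" and Q: "Q \<in> carrier_mat n n" and QQ: "Q * Q = 1\<^sub>m n"
  shows "Q * (Q * A * Q) * Q = A"
proof -
  have "Q * (Q * A * Q) * Q = (Q * Q) * A * (Q * Q)"
    using A Q by (simp add: assoc_mult_mat[of _ n n _ n _ n])
  then show ?thesis using QQ A by simp
qed

text \<open>An eigenvector exists over the complex numbers. A reflection \<open>Q\<close> moving it
  to the line of the first basis vector clears column 0 of \<open>Q * A * Q\<close> below the
  diagonal, and Hermitian symmetry clears row 0. An eigenvector of the remaining block, padded by a
  zero and mapped by \<open>Q\<close>, is one of \<open>A\<close>, so the block is again positive
  semidefinite.\<close>

lemma psd_mat_deflate:
  assumes A: "A \<in> carrier_mat (Suc n) (Suc n)" and psd: "psd_mat A"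
  obtains Q l B where "Q \<in> carrier_mat (Suc n) (Suc n)" "hermitian_mat Q" "Q * Q = 1\<^sub>m (Suc n)"
    "l \<ge> 0" "B \<in> carrier_mat n n" "psd_mat B"
    "Q * A * Q = mat (Suc n) (Suc n) (\<lambda>(i, j).
       if i = 0 \<and> j = 0 then of_real l
       else if i = 0 \<or> j = 0 then 0 else B $$ (i - 1, j - 1))"
proof -
  have herm: "hermitian_mat A" using psd by (simp add: psd_mat_def)
  obtain k where "eigenvalue A k"
    using spectrum_non_empty[OF A] unfolding spectrum_def by auto
  then obtain v where v: "eigenvector A v k" and k: "k \<in> \<real>" "Re k \<ge> 0"
    using psd unfolding psd_mat_def eigenvalue_def by metis
  have vc: "v \<in> carrier_vec (Suc n)" and v0: "v \<noteq> 0\<^sub>v (Suc n)" and Av: "A *\<^sub>v v = k \<cdot>\<^sub>v v"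
    using v A unfolding eigenvector_def by auto
  have e0: "unit_vec (Suc n) 0 \<noteq> (0\<^sub>v (Suc n) :: complex vec)"
    by (metis index_unit_vec(1) index_zero_vec(1) zero_less_Suc zero_neq_one)
  obtain Q a where Q: "Q \<in> carrier_mat (Suc n) (Suc n)" and Qh: "hermitian_mat Q"
    and QQ: "Q * Q = 1\<^sub>m (Suc n)" and Qv: "Q *\<^sub>v v = a \<cdot>\<^sub>v unit_vec (Suc n) 0"
    using reflection_to_line[OF vc _ e0] by auto
  have QQx: "Q *\<^sub>v (Q *\<^sub>v x) = x" if "x \<in> carrier_vec (Suc n)" for x
    using that Q QQ by (metis assoc_mult_mat_vec one_mult_mat_vec)
  have "a \<noteq> 0"
  proof
    assume "a = 0"
    then have "Q *\<^sub>v v = 0\<^sub>v (Suc n)" using Qv by auto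
    then have "v = Q *\<^sub>v 0\<^sub>v (Suc n)" using QQx[OF vc] by simp
    then show False using v0 Q by auto
  qed
  define M where "M = Q * A * Q"
  have M: "M \<in> carrier_mat (Suc n) (Suc n)" using A Q by (simp add: M_def)
  have Mx: "M *\<^sub>v x = Q *\<^sub>v (A *\<^sub>v (Q *\<^sub>v x))" if "x \<in> carrier_vec (Suc n)" for x
    using that A Q by (simp add: M_def assoc_mult_mat_vec[of _ "Suc n" "Suc n" _ "Suc n"])
  \<comment> \<open>Conjugation by \<open>Q\<close> carries the eigenvector \<open>v\<close> of
    \<open>A\<close> to the eigenvector \<open>Q *\<^sub>v v\<close> of \<open>M\<close>, with the
    same eigenvalue. Cancelling \<open>a\<close> then yields column 0 of \<open>M\<close>.\<close>
  have "a \<cdot>\<^sub>v (M *\<^sub>v unit_vec (Suc n) 0) = M *\<^sub>v (Q *\<^sub>v v)"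
    using M by (simp add: Qv mult_mat_vec)
  also have "\<dots> = Q *\<^sub>v (A *\<^sub>v v)"
    using Q vc by (simp add: Mx QQx)
  also have "\<dots> = k \<cdot>\<^sub>v (a \<cdot>\<^sub>v unit_vec (Suc n) 0)"
    using Q vc by (simp add: Av mult_mat_vec Qv)
  finally have aM: "a \<cdot>\<^sub>v (M *\<^sub>v unit_vec (Suc n) 0) = k \<cdot>\<^sub>v (a \<cdot>\<^sub>v unit_vec (Suc n) 0)" .
  have M0: "M $$ (i, 0) = (if i = 0 then k else 0)" if i: "i < Suc n" for i
  proof -
    have "(M *\<^sub>v unit_vec (Suc n) 0) $ i = (\<Sum>l<Suc n. if l = 0 then M $$ (i, l) else 0)"
      unfolding mult_mat_vec_index[OF M unit_vec_carrier i]
      by (intro sum.cong refl) (simp add: unit_vec_def)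
    also have "\<dots> = M $$ (i, 0)"
      by (subst sum.delta) auto
    finally have "a * M $$ (i, 0) = k * (a * (if i = 0 then 1 else 0))"
      using arg_cong[OF aM, of "\<lambda>x. x $ i"] i M by (simp add: unit_vec_def)
    then show ?thesis using \<open>a \<noteq> 0\<close> by auto
  qed
  have Mh: "hermitian_mat M"
  proof -
    have "mat_adjoint M = Q * (A * Q)"
      using Q A Qh herm unfolding M_def hermitian_mat_def
      by (simp add: mat_adjoint_mult[of _ "Suc n" "Suc n" _ "Suc n"])
    then show ?thesis
      using M A Q unfolding hermitian_mat_def
      by (auto simp: M_def assoc_mult_mat[of _ "Suc n" "Suc n" _ "Suc n"])
  qed
  define B where "B = mat n n (\<lambda>(i, j). M $$ (Suc i, Suc j))"
  have B: "B \<in> carrier_mat n n" by (simp add: B_def)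
  have kr: "k = of_real (Re k)" using k(1) by simp
  have M_eq: "M = mat (Suc n) (Suc n) (\<lambda>(i, j).
       if i = 0 \<and> j = 0 then of_real (Re k)
       else if i = 0 \<or> j = 0 then 0 else B $$ (i - 1, j - 1))"
  proof (rule eq_matI)
    fix i j
    assume "i < dim_row (mat (Suc n) (Suc n) (\<lambda>(i, j).
       if i = 0 \<and> j = 0 then of_real (Re k)
       else if i = 0 \<or> j = 0 then 0 else B $$ (i - 1, j - 1)))"
      and "j < dim_col (mat (Suc n) (Suc n) (\<lambda>(i, j).
       if i = 0 \<and> j = 0 then of_real (Re k)
       else if i = 0 \<or> j = 0 then 0 else B $$ (i - 1, j - 1)))"
    then have ij: "i < Suc n" "j < Suc n" by auto
    show "M $$ (i, j) = mat (Suc n) (Suc n) (\<lambda>(i, j).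
       if i = 0 \<and> j = 0 then of_real (Re k)
       else if i = 0 \<or> j = 0 then 0 else B $$ (i - 1, j - 1)) $$ (i, j)"
    proof (cases "i = 0 \<or> j = 0")
      case True
      then show ?thesis
        using ij M0 kr hermitian_mat_index[OF Mh M ij] by auto
    next
      case False
      then show ?thesis using ij by (auto simp: B_def)
    qed
  qed (use M in auto)
  have "hermitian_mat B"
  proof -
    have "mat_adjoint B = B"
      by (rule eq_matI)
        (auto simp: B_def hermitian_mat_index[OF Mh M, symmetric])
    then show ?thesis using B by (simp add: hermitian_mat_def)
  qed
  moreover have "m \<in> \<real> \<and> Re m \<ge> 0" if ev: "eigenvalue B m" for m
  proof -
    obtain y where y: "y \<in> carrier_vec n" "y \<noteq> 0\<^sub>v n" "B *\<^sub>v y = m \<cdot>\<^sub>v y"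
      using ev B unfolding eigenvalue_def eigenvector_def by auto
    \<comment> \<open>The padded vector: its leading zero hides column 0 of \<open>M\<close>, and
      row 0 of \<open>M\<close> vanishes elsewhere, so \<open>M\<close> acts on \<open>x\<close> as
      \<open>B\<close> acts on \<open>y\<close>.\<close>
    define x where "x = vec (Suc n) (\<lambda>i. if i = 0 then 0 else y $ (i - 1))"
    have x: "x \<in> carrier_vec (Suc n)" by (simp add: x_def)
    obtain i where i: "i < n" "y $ i \<noteq> 0"
      using y by (metis carrier_vecD eq_vecI index_zero_vec)
    then have "x $ Suc i \<noteq> 0\<^sub>v (Suc n) $ Suc i" by (simp add: x_def)
    then have x0: "x \<noteq> 0\<^sub>v (Suc n)" by metis
    have "M *\<^sub>v x = m \<cdot>\<^sub>v x"
    proof (rule eq_vecI)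
      fix i assume "i < dim_vec (m \<cdot>\<^sub>v x)"
      then have i: "i < Suc n" by (simp add: x_def)
      have *: "(M *\<^sub>v x) $ i = (\<Sum>l<n. M $$ (i, Suc l) * y $ l)"
        unfolding mult_mat_vec_index[OF M x i]
        by (subst sum.lessThan_Suc_shift) (simp add: x_def)
      show "(M *\<^sub>v x) $ i = (m \<cdot>\<^sub>v x) $ i"
      proof (cases i)
        case 0
        then show ?thesis unfolding * by (simp add: M_eq x_def)
      next
        case (Suc r)
        then have r: "r < n" using i by simp
        have "(M *\<^sub>v x) $ i = (\<Sum>l<n. B $$ (r, l) * y $ l)"
          unfolding * using Suc r by (simp add: B_def)
        also have "\<dots> = (B *\<^sub>v y) $ r" by (rule mult_mat_vec_index[OF B y(1) r, symmetric])
        finally show ?thesis using Suc r y by (simp add: x_def)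
      qed
    qed (use M x in auto)
    then have "Q *\<^sub>v (A *\<^sub>v (Q *\<^sub>v x)) = m \<cdot>\<^sub>v x" using Mx x by simp
    then have "A *\<^sub>v (Q *\<^sub>v x) = Q *\<^sub>v (m \<cdot>\<^sub>v x)"
      using QQx[of "A *\<^sub>v (Q *\<^sub>v x)"] A Q x by simp
    also have "\<dots> = m \<cdot>\<^sub>v (Q *\<^sub>v x)" using Q x by (simp add: mult_mat_vec)
    finally have "A *\<^sub>v (Q *\<^sub>v x) = m \<cdot>\<^sub>v (Q *\<^sub>v x)" .
    moreover have "Q *\<^sub>v x \<noteq> 0\<^sub>v (Suc n)"
    proof
      assume "Q *\<^sub>v x = 0\<^sub>v (Suc n)"
      then have "x = Q *\<^sub>v 0\<^sub>v (Suc n)" using QQx[OF x] by simp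
      then show False using x0 Q by auto
    qed
    ultimately have "eigenvalue A m"
      using A Q x unfolding eigenvalue_def eigenvector_def
      by (intro exI[of _ "Q *\<^sub>v x"]) auto
    then show ?thesis using psd by (simp add: psd_mat_def)
  qed
  ultimately have "psd_mat B" by (simp add: psd_mat_def)
  then show thesis
    using that[OF Q Qh QQ k(2) B] M_eq unfolding M_def by simp
qed

text \<open>Induction on the size: after splitting off the eigenvalue \<open>l\<close>, a Gram
  factor of the remaining block is bordered by \<open>sqrt l\<close>, and the reflection is
  undone.\<close>

lemma psd_mat_gram:
  assumes "A \<in> carrier_mat n n" "psd_mat A"
  shows "\<exists>W \<in> carrier_mat n n. mat_adjoint W * W = A"
  using assms
proof (induction n arbitrary: A)
  case 0
  then show ?case by (intro bexI[of _ A]) auto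
next
  case (Suc n)
  obtain Q l B where Q: "Q \<in> carrier_mat (Suc n) (Suc n)" "hermitian_mat Q" "Q * Q = 1\<^sub>m (Suc n)"
    and l: "l \<ge> 0" and B: "B \<in> carrier_mat n n" "psd_mat B"
    and QAQ: "Q * A * Q = mat (Suc n) (Suc n) (\<lambda>(i, j).
       if i = 0 \<and> j = 0 then of_real l
       else if i = 0 \<or> j = 0 then 0 else B $$ (i - 1, j - 1))"
    by (rule psd_mat_deflate[OF Suc.prems])
  obtain V where V: "V \<in> carrier_mat n n" "mat_adjoint V * V = B"
    using Suc.IH[OF B] by auto
  define D where "D = mat (Suc n) (Suc n) (\<lambda>(i, j).
       if i = 0 \<and> j = 0 then complex_of_real (sqrt l)
       else if i = 0 \<or> j = 0 then 0 else V $$ (i - 1, j - 1))"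
  have D: "D \<in> carrier_mat (Suc n) (Suc n)" by (simp add: D_def)
  have "mat_adjoint D * D = Q * A * Q"
  proof (rule eq_matI)
    fix i j assume "i < dim_row (Q * A * Q)" "j < dim_col (Q * A * Q)"
    then have ij: "i < Suc n" "j < Suc n" using Q by auto
    have "(mat_adjoint D * D) $$ (i, j) = (\<Sum>k<Suc n. cnj (D $$ (k, i)) * D $$ (k, j))"
      using ij D by (subst mult_mat_index[of _ "Suc n" "Suc n" _ "Suc n"])
        (auto simp del: sum.lessThan_Suc intro!: sum.cong)
    also have "\<dots> = cnj (D $$ (0, i)) * D $$ (0, j)
        + (\<Sum>k<n. cnj (D $$ (Suc k, i)) * D $$ (Suc k, j))"
      by (rule sum.lessThan_Suc_shift)
    also have "\<dots> = (Q * A * Q) $$ (i, j)"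
    proof (cases "i = 0 \<or> j = 0")
      case True
      then show ?thesis
        using ij l unfolding QAQ
        by (auto simp: D_def of_real_mult[symmetric] simp del: of_real_mult)
    next
      case False
      then obtain r s where rs: "i = Suc r" "j = Suc s" by (meson not0_implies_Suc)
      then have lt: "r < n" "s < n" using ij by auto
      have "(mat_adjoint V * V) $$ (r, s) = (\<Sum>k<n. cnj (V $$ (k, r)) * V $$ (k, s))"
        using lt V by (subst mult_mat_index[of _ n n _ n]) auto
      then show ?thesis
        using ij rs unfolding QAQ V(2) by (simp add: D_def)
    qed
    finally show "(mat_adjoint D * D) $$ (i, j) = (Q * A * Q) $$ (i, j)" .
  qed (use Q D in auto)
  \<comment> \<open>\<open>Q\<close> is its own adjoint and its own inverse, so multiplying the
    factor \<open>D\<close> by \<open>Q\<close> on the right turns a Gram factor of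
    \<open>Q * A * Q\<close> into one of \<open>A\<close>.\<close>
  then have "Q * (mat_adjoint D * D) * Q = A"
    by (simp only: involution_similar[OF Suc.prems(1) Q(1,3)])
  moreover have adj: "mat_adjoint Q = Q" using Q(2) by (simp add: hermitian_mat_def)
  have "mat_adjoint (D * Q) * (D * Q) = Q * (mat_adjoint D * D) * Q"
    unfolding mat_adjoint_mult[OF D Q(1)] adj
    by (rule mult_mat_regroup[OF Q(1) mat_adjoint_carrier[OF D] D Q(1)])
  ultimately show ?case using D Q by (intro bexI[of _ "D * Q"]) auto
qed

section \<open>Uniform Gram matrices have rank at most one\<close>

text \<open>Equality in the Cauchy--Schwarz inequality: every column of \<open>V\<close> is a multiple of
  column 0. The multiplier is \<open>0\<close> if \<open>c = 0\<close>, which is consistent since then \<open>V = 0\<close>.\<close>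

lemma uniform_gram_product_entries:
  fixes V :: "complex mat"
  assumes V: "V \<in> carrier_mat m n" and unif: "uniform_mat (mat_adjoint V * V)"
  shows "\<exists>f g. \<forall>i<m. \<forall>j<n. V $$ (i, j) = f i * g j"
proof -
  define B where "B = mat_adjoint V * V"
  obtain c where c: "c \<ge> 0" "\<And>k j. k < n \<Longrightarrow> j < n \<Longrightarrow> cmod (B $$ (k, j)) = c"
    using unif V unfolding uniform_mat_def B_def by auto
  have B_index: "B $$ (k, j) = (\<Sum>i<m. cnj (V $$ (i, k)) * V $$ (i, j))"
    if "k < n" "j < n" for k j
    using that V unfolding B_def by (subst mult_mat_index[of _ n m _ n]) auto
  \<comment> \<open>A diagonal entry is the squared length of a column, hence nonnegative and equal
    to its modulus \<open>c\<close>.\<close>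
  have B_diag: "B $$ (j, j) = of_real c" if j: "j < n" for j
  proof -
    have *: "B $$ (j, j) = of_real (\<Sum>i<m. (cmod (V $$ (i, j)))\<^sup>2)"
      unfolding B_index[OF j j] of_real_sum complex_norm_square by (simp add: mult.commute)
    have "0 \<le> (\<Sum>i<m. (cmod (V $$ (i, j)))\<^sup>2)" by (simp add: sum_nonneg)
    then show ?thesis using c(2)[OF j j] unfolding * norm_of_real by simp
  qed
  have multiple: "V $$ (i, j) = V $$ (i, 0) * (B $$ (0, j) / c)" if i: "i < m" and j: "j < n" for i j
  proof -
    have n: "0 < n" using j by simp
    define a where "a = B $$ (0, j) / c"
    \<comment> \<open>For \<open>c = 0\<close> the entry itself is zero, so the convention
      \<open>x / 0 = 0\<close> keeps this equation valid.\<close>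
    have ac: "B $$ (0, j) = a * c"
      using c(2)[OF n j] by (cases "c = 0") (auto simp: a_def)
    have "B $$ (j, 0) = cnj (B $$ (0, j))"
      using j n by (simp add: B_index mult.commute)
    then have ca: "B $$ (j, 0) = cnj a * c" by (simp add: ac)
    have aac: "a * cnj a * c = c"
    proof (cases "c = 0")
      case False
      then have "cmod a = 1" using c(1) c(2)[OF n j] by (simp add: a_def norm_divide)
      then show ?thesis by (simp add: complex_norm_square[symmetric] del: of_real_power)
    qed simp
    \<comment> \<open>The squared distance between column \<open>j\<close> and \<open>a\<close>
      times column 0 expands into four entries of \<open>B\<close>. Their values are
      \<open>c\<close>, \<open>c\<close>, \<open>c\<close> and \<open>c\<close> with signs +, -, -,
      +, so the distance is zero.\<close>
    have "complex_of_real (\<Sum>i<m. (cmod (V $$ (i, j) - V $$ (i, 0) * a))\<^sup>2)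
      = (\<Sum>i<m. cnj (V $$ (i, j)) * V $$ (i, j) - a * (cnj (V $$ (i, j)) * V $$ (i, 0))
          - cnj a * (cnj (V $$ (i, 0)) * V $$ (i, j))
          + a * cnj a * (cnj (V $$ (i, 0)) * V $$ (i, 0)))"
      unfolding of_real_sum complex_norm_square
      by (intro sum.cong refl) (simp add: algebra_simps)
    also have "\<dots> = B $$ (j, j) - a * B $$ (j, 0) - cnj a * B $$ (0, j) + a * cnj a * B $$ (0, 0)"
      using j n by (simp add: B_index sum.distrib sum_subtractf sum_distrib_left)
    also have "\<dots> = 0"
      using aac unfolding B_diag[OF j] B_diag[OF n] ac ca by (simp add: algebra_simps)
    finally have "(\<Sum>i<m. (cmod (V $$ (i, j) - V $$ (i, 0) * a))\<^sup>2) = 0"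
      by (simp only: of_real_eq_0_iff)
    then have "\<forall>i\<in>{..<m}. (cmod (V $$ (i, j) - V $$ (i, 0) * a))\<^sup>2 = 0"
      by (subst (asm) sum_nonneg_eq_0_iff) auto
    then show ?thesis using i by (simp add: a_def)
  qed
  show ?thesis
    by (rule exI[of _ "\<lambda>i. V $$ (i, 0)"], rule exI[of _ "\<lambda>j. B $$ (0, j) / c"])
      (intro allI impI multiple)
qed

text \<open>With \<open>H\<close> written as a Gram matrix of \<open>W\<close>, the congruence is
  the Gram matrix of \<open>W * C\<close>, whose entries therefore factor as
  \<open>f i * g j\<close>. Cancelling the invertible \<open>C\<close> passes this product form on
  to \<open>W\<close>, and from there to \<open>H\<close>.\<close>

lemma psd_uniform_congruence_rank_le_1:
  assumes H: "H \<in> carrier_mat n n" "psd_mat H"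
    and C: "C \<in> carrier_mat n n" "invertible_mat C"
    and unif: "uniform_mat (mat_adjoint C * H * C)"
  shows "vec_space.rank n H \<le> 1"
proof -
  obtain W where W: "W \<in> carrier_mat n n" "mat_adjoint W * W = H"
    using psd_mat_gram[OF H] by auto
  obtain D where CD: "C * D = 1\<^sub>m n" "D * C = 1\<^sub>m (dim_row D)"
    using C unfolding invertible_mat_def inverts_mat_def by auto
  \<comment> \<open>\<open>invertible_mat\<close> leaves the shape of the inverse open; it is read
    off from the two products.\<close>
  have D: "D \<in> carrier_mat n n"
    using CD C by (metis carrier_matD(2) carrier_matI index_mult_mat(3) index_one_mat(3))
  have "mat_adjoint (W * C) * (W * C) = mat_adjoint C * H * C"
    unfolding mat_adjoint_mult[OF W(1) C(1)] W(2)[symmetric]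
    using W(1) C(1) by (intro mult_mat_regroup) auto
  then obtain f g where fg: "\<And>i j. i < n \<Longrightarrow> j < n \<Longrightarrow> (W * C) $$ (i, j) = f i * g j"
    using uniform_gram_product_entries[of "W * C" n n] W C unif by auto
  define h where "h j = (\<Sum>l<n. g l * D $$ (l, j))" for j
  have "W = W * (C * D)" using W CD by simp
  also have "\<dots> = (W * C) * D" using W C D by simp
  finally have WCD: "W = (W * C) * D" .
  have W_index: "W $$ (i, j) = f i * h j" if ij: "i < n" "j < n" for i j
  proof -
    have "W $$ (i, j) = (\<Sum>l<n. (W * C) $$ (i, l) * D $$ (l, j))"
      using ij W C D by (subst WCD, intro mult_mat_index) auto
    then show ?thesis using ij by (simp add: fg h_def sum_distrib_left mult.assoc)
  qed
  \<comment> \<open>The sum over \<open>f\<close> is a scalar independent of \<open>i\<close> and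
    \<open>j\<close>, so the entries of \<open>H\<close> again separate into a row factor and a
    column factor.\<close>
  have "H $$ (i, j) = cnj (h i) * ((\<Sum>l<n. cnj (f l) * f l) * h j)"
    if ij: "i < n" "j < n" for i j
  proof -
    have "H $$ (i, j) = (\<Sum>l<n. mat_adjoint W $$ (i, l) * W $$ (l, j))"
      unfolding W(2)[symmetric] using ij W by (intro mult_mat_index) auto
    also have "\<dots> = (\<Sum>l<n. cnj (h i) * (cnj (f l) * f l * h j))"
      using ij W by (intro sum.cong refl) (auto simp: W_index)
    finally show ?thesis by (simp add: sum_distrib_left sum_distrib_right)
  qed
  then show ?thesis
    using H by (intro vec_space.rank_le_1_product_entries[OF H(1)]) auto
qed

section \<open>From rank at most one to a uniform matrix\<close>

text \<open>Two distinct columns must be linearly dependent, as otherwise the rank would be at least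
  2. A nontrivial relation between them makes every 2 by 2 minor vanish.\<close>

lemma (in vec_space) rank_le_1_minor:
  assumes A: "A \<in> carrier_mat n nc" and rank: "rank A \<le> 1"
    and lt: "r < n" "s < n" "i < nc" "j < nc"
  shows "A $$ (r, i) * A $$ (s, j) = A $$ (r, j) * A $$ (s, i)"
\<comment> \<open>Equal columns are treated apart: as a set they collapse to a single vector, which
  may well be independent.\<close>
proof (cases "col A i = col A j")
  case True
  then have "A $$ (t, i) = A $$ (t, j)" if "t < n" for t
    using that A lt by (metis carrier_matD index_col)
  then show ?thesis using lt by simp
next
  case False
  let ?M = "mat_of_cols n [col A i, col A j]"
  have M: "?M \<in> carrier_mat n 2"
    using mat_of_cols_carrier(1)[of n "[col A i, col A j]"] by (simp add: numeral_2_eq_2)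
  have cols_M: "cols ?M = [col A i, col A j]"
    using A by (subst cols_mat_of_cols) (auto simp: col_dim)
  have "lin_dep {col A i, col A j}"
  proof (rule ccontr)
    assume "\<not> lin_dep {col A i, col A j}"
    moreover have "{col A i, col A j} \<subseteq> set (cols A)"
      using A lt by (auto simp: cols_def)
    ultimately have "card {col A i, col A j} \<le> rank A"
      using rank_ge_card_indpt[OF A] by blast
    then show False using False rank by simp
  qed
  then obtain v where v: "v \<in> carrier_vec 2" "v \<noteq> 0\<^sub>v 2" "?M *\<^sub>v v = 0\<^sub>v n"
    using lin_depE[OF M] False unfolding cols_M by auto
  have rel: "A $$ (t, i) * v $ 0 + A $$ (t, j) * v $ 1 = 0" if t: "t < n" for t
  proof -
    have "0 = (\<Sum>l<2. ?M $$ (t, l) * v $ l)"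
      using mult_mat_vec_index[OF M v(1) t] t unfolding v(3) by simp
    then show ?thesis using t A lt by (simp add: numeral_2_eq_2 mat_of_cols_index)
  qed
  have "v $ 0 \<noteq> 0 \<or> v $ 1 \<noteq> 0"
  proof (rule ccontr)
    assume "\<not> ?thesis"
    then have "v = 0\<^sub>v 2" using v(1) by (intro eq_vecI) (auto simp: less_2_cases_iff)
    then show False using v(2) by simp
  qed
  then show ?thesis
  proof
    assume v0: "v $ 0 \<noteq> 0"
    \<comment> \<open>Cramer elimination: combining the relations in rows \<open>r\<close> and
      \<open>s\<close> removes \<open>v $ 1\<close> and leaves \<open>v $ 0\<close> times the
      minor.\<close>
    have "v $ 0 * (A $$ (r, i) * A $$ (s, j) - A $$ (r, j) * A $$ (s, i))
      = (A $$ (r, i) * v $ 0 + A $$ (r, j) * v $ 1) * A $$ (s, j)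
        - (A $$ (s, i) * v $ 0 + A $$ (s, j) * v $ 1) * A $$ (r, j)"
      by (simp add: algebra_simps)
    then show ?thesis using v0 rel lt by simp
  next
    assume v1: "v $ 1 \<noteq> 0"
    have "v $ 1 * (A $$ (r, i) * A $$ (s, j) - A $$ (r, j) * A $$ (s, i))
      = (A $$ (s, i) * v $ 0 + A $$ (s, j) * v $ 1) * A $$ (r, i)
        - (A $$ (r, i) * v $ 0 + A $$ (r, j) * v $ 1) * A $$ (s, i)"
      by (simp add: algebra_simps)
    then show ?thesis using v1 rel lt by simp
  qed
qed

text \<open>With a nonzero diagonal entry at \<open>k\<close>, the vanishing minors express every
  entry through column \<open>k\<close> and row \<open>k\<close>, and row \<open>k\<close> is the
  conjugate of column \<open>k\<close>. So \<open>v\<close> is that column and \<open>t\<close> the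
  reciprocal of the diagonal entry.\<close>

lemma hermitian_rank_le_1_outer_product:
  assumes H: "H \<in> carrier_mat n n" "hermitian_mat H" and rank: "vec_space.rank n H \<le> 1"
  shows "\<exists>t. \<exists>v \<in> carrier_vec n. \<forall>i<n. \<forall>j<n. H $$ (i, j) = t * (v $ i * cnj (v $ j))"
proof -
  note minor = vec_space.rank_le_1_minor[OF H(1) rank]
  note herm = hermitian_mat_index[OF H(2,1)]
  show ?thesis
  proof (cases "\<exists>k<n. H $$ (k, k) \<noteq> 0")
    case True
    then obtain k where k: "k < n" "H $$ (k, k) \<noteq> 0" by auto
    have "H $$ (i, j) = 1 / H $$ (k, k) * (col H k $ i * cnj (col H k $ j))"
      if ij: "i < n" "j < n" for i j
    proof -
      have "H $$ (i, j) * H $$ (k, k) = H $$ (i, k) * cnj (H $$ (j, k))"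
        using minor[of i k j k] herm[of k j] ij k by simp
      then show ?thesis using k ij H by (simp add: field_simps)
    qed
    then show ?thesis
      using H by (intro exI[of _ "1 / H $$ (k, k)"] bexI[of _ "col H k"]) auto
  next
    case False
    \<comment> \<open>With a zero diagonal, the principal minor on \<open>i\<close> and
      \<open>j\<close> reduces to the squared modulus of \<open>H $$ (i, j)\<close>, so
      \<open>H\<close> is zero.\<close>
    have "H $$ (i, j) = 0" if ij: "i < n" "j < n" for i j
    proof -
      have "H $$ (i, j) * cnj (H $$ (i, j)) = 0"
        using minor[of i j j i] herm[of j i] ij False by simp
      then show ?thesis by simp
    qed
    then show ?thesis by (intro exI[of _ 0] bexI[of _ "0\<^sub>v n"]) auto
  qed
qed

text \<open>Conjugating \<open>t v v^*\<close> by \<open>Q\<close> gives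
  \<open>t (Q v) (Q v)^*\<close>. If \<open>Q v\<close> is \<open>a\<close> times the all-ones
  vector, every entry equals \<open>t * a * cnj a\<close>.\<close>

lemma hermitian_rank_le_1_apportionable:
  assumes H: "H \<in> carrier_mat n n" "hermitian_mat H" and rank: "vec_space.rank n H \<le> 1"
  shows "U_apportionable H"
\<comment> \<open>In size 0 the all-ones vector is the zero vector and spans no line to reflect
  onto.\<close>
proof (cases "n = 0")
  case True
  then show ?thesis
    using H unfolding U_apportionable_def unitary_mat_def uniform_mat_def
    by (intro conjI bexI[of _ "1\<^sub>m n"] exI[of _ 0]) (auto intro!: eq_matI)
next
  case False
  obtain t v where v: "v \<in> carrier_vec n"
    and Hv: "\<And>i j. i < n \<Longrightarrow> j < n \<Longrightarrow> H $$ (i, j) = t * (v $ i * cnj (v $ j))"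
    using hermitian_rank_le_1_outer_product[OF assms] by auto
  define w :: "complex vec" where "w = vec n (\<lambda>_. 1)"
  have w: "w \<in> carrier_vec n" by (simp add: w_def)
  have "w $ 0 \<noteq> 0\<^sub>v n $ 0" using False by (simp add: w_def)
  then have "w \<noteq> 0\<^sub>v n" by auto
  then obtain Q a where Q: "Q \<in> carrier_mat n n" "hermitian_mat Q" "Q * Q = 1\<^sub>m n"
    and Qv: "Q *\<^sub>v v = a \<cdot>\<^sub>v w"
    using reflection_to_line[OF v w] by metis
  have adj: "mat_adjoint Q = Q" using Q(2) by (simp add: hermitian_mat_def)
  have Qv_index: "(\<Sum>l<n. Q $$ (i, l) * v $ l) = a" if "i < n" for i
    using mult_mat_vec_index[OF Q(1) v that] that by (simp add: Qv w_def)
  have "cmod ((Q * H * Q) $$ (i, j)) = cmod t * (cmod a)\<^sup>2" if ij: "i < n" "j < n" for i j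
  proof -
    have QH: "(Q * H) $$ (i, k) = a * (t * cnj (v $ k))" if k: "k < n" for k
    proof -
      have "(Q * H) $$ (i, k) = (\<Sum>l<n. (Q $$ (i, l) * v $ l) * (t * cnj (v $ k)))"
        unfolding mult_mat_index[OF Q(1) H(1) ij(1) k]
        using k by (intro sum.cong refl) (simp add: Hv)
      then show ?thesis by (simp only: sum_distrib_right[symmetric] Qv_index[OF ij(1)])
    qed
    have "(Q * H * Q) $$ (i, j) = (\<Sum>k<n. (Q * H) $$ (i, k) * Q $$ (k, j))"
      using Q H ij by (intro mult_mat_index) auto
    \<comment> \<open>As \<open>Q\<close> is Hermitian, column \<open>j\<close> is the conjugate of
      row \<open>j\<close>, and the sum becomes the conjugate of entry \<open>j\<close> of
      \<open>Q *\<^sub>v v\<close>.\<close>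
    also have "\<dots> = (\<Sum>k<n. a * t * cnj (Q $$ (j, k) * v $ k))"
      using ij hermitian_mat_index[OF Q(2,1) _ ij(2)]
      by (intro sum.cong refl) (simp add: QH)
    also have "\<dots> = a * t * cnj a"
      by (simp only: sum_distrib_left[symmetric] cnj_sum[symmetric] Qv_index[OF ij(2)])
    finally show ?thesis by (simp add: norm_mult power2_eq_square)
  qed
  then have "uniform_mat (Q * H * mat_adjoint Q)"
    using Q H unfolding uniform_mat_def adj
    by (intro conjI exI[of _ "cmod t * (cmod a)\<^sup>2"]) auto
  moreover have "unitary_mat Q" using Q adj by (auto simp: unitary_mat_def)
  ultimately show ?thesis
    using Q H unfolding U_apportionable_def by auto
qed

theorem proposition2p3:
  fixes n :: nat and H :: "complex mat"
  assumes "H \<in> carrier_mat n n"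
    and "psd_mat H"
  shows "(\<forall>C \<in> carrier_mat n n. invertible_mat C \<longrightarrow> uniform_mat (mat_adjoint C * H * C)
            \<longrightarrow> vec_space.rank n H \<le> 1)
       \<and> (U_apportionable H \<longleftrightarrow> vec_space.rank n H \<le> 1)"
proof (intro conjI ballI impI iffI)
  fix C assume "C \<in> carrier_mat n n" "invertible_mat C" "uniform_mat (mat_adjoint C * H * C)"
  then show "vec_space.rank n H \<le> 1" by (rule psd_uniform_congruence_rank_le_1[OF assms])
next
  assume "U_apportionable H"
  then obtain U where U: "U \<in> carrier_mat n n" "mat_adjoint U * U = 1\<^sub>m n"
    and unif: "uniform_mat (U * H * mat_adjoint U)"
    using assms(1) unfolding U_apportionable_def unitary_mat_def by auto
  \<comment> \<open>Unitary similarity is the congruence with \<open>C = mat_adjoint U\<close>. Its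
    invertibility needs both one-sided inverses, and for square matrices one gives the
    other.\<close>
  have "U * mat_adjoint U = 1\<^sub>m n"
    by (rule mat_mult_left_right_inverse[OF mat_adjoint_carrier[OF U(1)] U])
  then have "invertible_mat (mat_adjoint U)"
    using U unfolding invertible_mat_def inverts_mat_def
    by (intro conjI exI[of _ U]) auto
  then show "vec_space.rank n H \<le> 1"
    using psd_uniform_congruence_rank_le_1[OF assms, of "mat_adjoint U"] U unif by simp
next
  assume "vec_space.rank n H \<le> 1"
  then show "U_apportionable H"
    using hermitian_rank_le_1_apportionable[OF assms(1)] assms(2) by (simp add: psd_mat_def)
qed

end
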